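(* Let $d\ge 2$ be an integer, $p$ a prime, and $H,N\le p$ positive integers. Let $A_1,\dots,A_d$ be integers and let \[ \mathfrak B=[A_1+1,A_1+H]\times\dots\times[A_d+1,A_d+H] \] (viewed, via reduction modulo $p$, as a set of $H^d$ vectors in $\mathbb{F}_p^d$). Then for any positive integer $s<d$, \begin{align*} M_{d,2s}(\mathfrak B;N)&\ll \min\Big\{pH^{-1}N^s,\; p^{1/2}H^{-1/2}\big(N^s+N^{2s-d/2}\big)\Big\}\\ &\qquad+\min\Big\{(p/H)^dN^{s-1/2},\;(p/H)^{d/2}\big(N^s+N^{2s-d/2}\big)\Big\}, \end{align*} where the implied constant depends only on $d$.
   Context: $\mathbf{e}_p(z)=\exp(2\pi i z/p)$, and elements of $\mathbb{F}_p$ are represented by $\{0,\dots,p-1\}$. For $\vec a=(a_1,\dots,a_d)\in\mathbb{F}_p^d$ and a positive integer $N$, \[ S(\vec a;N)=\sum_{n=1}^N \mathbf{e}_p\big(a_1n+\dots+a_dn^d\big). \] For a nonempty set $\mathfrak U\subseteq\mathbb{F}_p^d$ of cardinality $U$ and $k>0$, \[ M_{d,k}(\mathfrak U;N)=\frac{1}{U}\sum_{\vec a\in\mathfrak U}|S(\vec a;N)|^k. \] The notation $A\ll B$ means $|A|\le cB$ for some constant $c>0$. *)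

theory Defs
  imports Complex_Main "HOL-Library.FuncSet" "HOL-Computational_Algebra.Primes"
begin

definition e_p :: "nat \<Rightarrow> complex \<Rightarrow> complex" where
  "e_p p z = exp (2 * of_real pi * \<i> * z / of_nat p)"

(* Elements of F_p are represented by 0, ..., p - 1; a vector (a_1, ..., a_d) is a function on
   {1..d}, extended by undefined outside this index set, so that the set has exactly p^d elements. *)
definition Fp_vecs :: "nat \<Rightarrow> nat \<Rightarrow> (nat \<Rightarrow> int) set" where
  "Fp_vecs p d = {1..d} \<rightarrow>\<^sub>E {0..<int p}"

definition weyl_sum :: "nat \<Rightarrow> nat \<Rightarrow> (nat \<Rightarrow> int) \<Rightarrow> nat \<Rightarrow> complex" where
  "weyl_sum p d a N = (\<Sum>n=1..N. e_p p (of_int (\<Sum>i=1..d. a i * int n ^ i)))"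

(* Only meaningful for nonempty U contained in Fp_vecs p d and k > 0. *)
definition mean_value :: "nat \<Rightarrow> nat \<Rightarrow> real \<Rightarrow> (nat \<Rightarrow> int) set \<Rightarrow> nat \<Rightarrow> real" where
  "mean_value p d k U N = 1 / real (card U) * (\<Sum>a\<in>U. cmod (weyl_sum p d a N) powr k)"

definition reduce_mod :: "nat \<Rightarrow> nat \<Rightarrow> (nat \<Rightarrow> int) \<Rightarrow> (nat \<Rightarrow> int)" where
  "reduce_mod p d a = (\<lambda>i\<in>{1..d}. a i mod int p)"

definition residue_box :: "nat \<Rightarrow> nat \<Rightarrow> (nat \<Rightarrow> int) \<Rightarrow> nat \<Rightarrow> (nat \<Rightarrow> int) set" where
  "residue_box p d A H = reduce_mod p d ` (\<Pi>\<^sub>E i\<in>{1..d}. {A i + 1..A i + int H})"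

lemma residue_box_subset: "p > 0 \<Longrightarrow> residue_box p d A H \<subseteq> Fp_vecs p d"
  by (auto simp: residue_box_def Fp_vecs_def reduce_mod_def)

lemma card_residue_box:
  assumes "H \<le> p"
  shows "card (residue_box p d A H) = H ^ d"
proof -
  let ?B = "\<Pi>\<^sub>E i\<in>{1..d}. {A i + 1..A i + int H}"
  have "inj_on (reduce_mod p d) ?B"
  proof (rule inj_onI)
    fix a b assume a: "a \<in> ?B" and b: "b \<in> ?B" and eq: "reduce_mod p d a = reduce_mod p d b"
    show "a = b"
    proof (rule PiE_ext[OF a b])
      fix i assume i: "i \<in> {1..d}"
      have "a i mod int p = b i mod int p"
        using fun_cong[OF eq, of i] i by (simp add: reduce_mod_def)
      hence dvd: "int p dvd a i - b i" by (simp add: mod_eq_dvd_iff)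
      have "a i \<in> {A i + 1..A i + int H}" "b i \<in> {A i + 1..A i + int H}"
        using a b i by (auto simp: PiE_iff)
      hence "\<bar>a i - b i\<bar> < int p" using assms by auto
      with dvd show "a i = b i" using zdvd_imp_le[of "int p" "\<bar>a i - b i\<bar>"] by force
    qed
  qed
  thus ?thesis by (simp add: residue_box_def card_image card_PiE)
qed

end

theory Submission
  imports Defs "HOL-Analysis.Complex_Transcendental" "HOL-Number_Theory.Cong"
    "HOL-Computational_Algebra.Formal_Power_Series" "HOL-Combinatorics.Multiset_Permutations"
begin

text \<open>
  If \<open>p \<le> d\<close>, the trivial bound \<open>N ^ (2 s)\<close> is a constant, so let \<open>d < p\<close>. Let \<open>J \<lambda>\<close> be the number of
  pairs of \<open>s\<close>-tuples from \<open>{1..N}\<close> whose first \<open>d\<close> power sums differ by \<open>\<lambda>\<close> modulo \<open>p\<close>. By Newton's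
  identities a tuple of length at most \<open>d\<close> is determined up to order by its power sums, so \<open>J 0 << N ^ s\<close>.
  For \<open>\<lambda> \<noteq> 0\<close>, the power series \<open>\<Prod>(1 - y X)\<close> of the second tuple agrees up to degree \<open>d\<close> with the
  product of that of the first tuple and a fixed nontrivial series depending only on \<open>\<lambda>\<close>. Since it has
  degree \<open>s < d\<close>, this is a nontrivial condition on the first tuple, and \<open>J \<lambda> << N ^ (s - 1)\<close>.

  Expanding the mean value and smoothing the box gives the bound
  \<open>J 0 + (p / H) ^ d * Max {J \<lambda> | \<lambda> \<noteq> 0}\<close>. Here \<open>J 0\<close> is covered by the first minimum and the other
  term by the first entry of the second minimum. The second entry of the second minimum follows from
  the Cauchy-Schwarz inequality, extending the summation of the moment of order \<open>4 s\<close> to all of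
  \<open>F_p^d\<close> and fixing all but \<open>d\<close> of the variables in the resulting system of congruences.
\<close>

unbundle no vec_syntax
unbundle fps_syntax

section \<open>Newton's identities modulo a prime\<close>

definition power_sum :: "int multiset \<Rightarrow> nat \<Rightarrow> int" where
  "power_sum M i = (\<Sum>x\<in>#M. x ^ i)"

text \<open>The reversal of the monic polynomial with roots \<open>M\<close>; its coefficients are,
  up to sign, the elementary symmetric functions. Constant term 1 makes it invertible as a power
  series over the integers.\<close>

definition recip_fps :: "int multiset \<Rightarrow> int fps" where
  "recip_fps M = (\<Prod>x\<in>#M. 1 - fps_const x * fps_X)"

text \<open>The inverse of \<open>recip_fps M\<close>, with the complete homogeneous symmetric
  functions as coefficients.\<close>

definition geom_fps :: "int multiset \<Rightarrow> int fps" where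
  "geom_fps M = (\<Prod>x\<in>#M. Abs_fps (\<lambda>i. x ^ i))"

text \<open>Congruence modulo the ideal generated by \<open>q\<close> and
  \<open>X^(d+1)\<close>.\<close>

definition fps_cong :: "int \<Rightarrow> nat \<Rightarrow> int fps \<Rightarrow> int fps \<Rightarrow> bool" where
  "fps_cong q d f g \<longleftrightarrow> (\<forall>i\<le>d. [f $ i = g $ i] (mod q))"

lemma power_sum_union [simp]: "power_sum (M + M') i = power_sum M i + power_sum M' i"
  by (simp add: power_sum_def)

lemma recip_fps_union [simp]: "recip_fps (M + M') = recip_fps M * recip_fps M'"
  by (simp add: recip_fps_def)

lemma recip_fps_add_mset [simp]: "recip_fps (add_mset x M) = (1 - fps_const x * fps_X) * recip_fps M"
  by (simp add: recip_fps_def)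

lemma recip_fps_empty [simp]: "recip_fps {#} = 1"
  by (simp add: recip_fps_def)

lemma linear_mult_nth_Suc:
  "((1 - fps_const x * fps_X) * f) $ Suc n = f $ Suc n - x * f $ n" for f :: "int fps"
  by (simp add: left_diff_distrib mult.assoc)

lemma linear_mult_nth_0: "((1 - fps_const x * fps_X) * f) $ 0 = f $ 0" for f :: "int fps"
  by simp

lemma geom_mult: "(1 - fps_const x * fps_X) * Abs_fps (\<lambda>i. x ^ i) = (1 :: int fps)"
proof (rule fps_ext)
  fix n show "((1 - fps_const x * fps_X) * Abs_fps (\<lambda>i. x ^ i)) $ n = (1 :: int fps) $ n"
    by (cases n) (auto simp only: linear_mult_nth_Suc linear_mult_nth_0, auto)
qed

lemma recip_mult_geom: "recip_fps M * geom_fps M = 1"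
  by (simp add: recip_fps_def geom_fps_def geom_mult flip: prod_mset.distrib)

lemma recip_fps_nth_0 [simp]: "recip_fps M $ 0 = 1"
  by (induction M) (auto simp: linear_mult_nth_0)

lemma recip_fps_nth_gt: "n > size M \<Longrightarrow> recip_fps M $ n = 0"
proof (induction M arbitrary: n)
  case (add x M)
  then obtain m where "n = Suc m" by (cases n) auto
  with add show ?case by (auto simp: linear_mult_nth_Suc)
qed auto

text \<open>Undoes the reversal, so that congruent coefficients can be turned into congruent values
  of the polynomials with roots \<open>M\<close>.\<close>

lemma prod_mset_diff_eq:
  "(\<Prod>x\<in>#M. t - x) = (\<Sum>i\<le>size M. recip_fps M $ i * t ^ (size M - i))" for t :: int
proof (induction M)
  case (add x M)
  let ?k = "size M" and ?c = "\<lambda>i. recip_fps M $ i"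
  have "(\<Sum>i\<le>size (add_mset x M). recip_fps (add_mset x M) $ i * t ^ (size (add_mset x M) - i))
     = t ^ Suc ?k + (\<Sum>i\<le>?k. (?c (Suc i) - x * ?c i) * t ^ (?k - i))"
    by (simp add: sum.atMost_Suc_shift linear_mult_nth_Suc linear_mult_nth_0 del: sum.atMost_Suc)
  also have "\<dots> = (\<Sum>i\<le>Suc ?k. ?c i * t ^ (Suc ?k - i)) - x * (\<Sum>i\<le>?k. ?c i * t ^ (?k - i))"
    by (simp add: sum.atMost_Suc_shift sum_subtractf sum_distrib_left left_diff_distrib mult.assoc
         del: sum.atMost_Suc)
  also have "(\<Sum>i\<le>Suc ?k. ?c i * t ^ (Suc ?k - i)) = t * (\<Sum>i\<le>?k. ?c i * t ^ (?k - i))"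
    by (simp add: recip_fps_nth_gt sum_distrib_left Suc_diff_le mult.left_commute)
  finally show ?case using add by (simp add: algebra_simps)
qed simp

text \<open>The logarithmic derivative of \<open>1 - x X\<close> is minus the series of
  \<open>x^(i+1) X^i\<close>; these add up over the factors to minus the generating series of the
  power sums.\<close>

lemma fps_deriv_recip:
  "fps_deriv (recip_fps M) = - (recip_fps M * Abs_fps (\<lambda>i. power_sum M (Suc i)))"
proof (induction M)
  case empty
  show ?case by (auto simp: power_sum_def intro: fps_ext)
next
  case (add x M)
  define l where "l = 1 - fps_const x * fps_X"
  define g where "g = Abs_fps (\<lambda>i. x ^ i)"
  define G where "G = Abs_fps (\<lambda>i. power_sum M (Suc i))"
  have lg: "l * g = 1" unfolding l_def g_def by (rule geom_mult)
  have dl: "fps_deriv l = - fps_const x" by (simp add: l_def)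
  have G': "Abs_fps (\<lambda>i. power_sum (add_mset x M) (Suc i)) = fps_const x * g + G"
    by (rule fps_ext) (simp add: g_def G_def power_sum_def)
  have "fps_deriv (recip_fps (add_mset x M)) = l * fps_deriv (recip_fps M) + fps_deriv l * recip_fps M"
    unfolding recip_fps_add_mset l_def by (rule fps_deriv_mult)
  also have "\<dots> = - (1 * (fps_const x * recip_fps M) + l * (recip_fps M * G))"
    unfolding dl add.IH G_def by (simp del: fps_const_neg)
  also have "\<dots> = - (l * recip_fps M * (fps_const x * g + G))"
    unfolding lg[symmetric] by (simp only: distrib_left mult_ac)
  finally show ?case by (simp only: G' l_def recip_fps_add_mset)
qed

lemma newton_identity:
  "of_nat (Suc n) * recip_fps M $ Suc n = - (\<Sum>i=0..n. recip_fps M $ i * power_sum M (Suc (n - i)))"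
  using arg_cong[OF fps_deriv_recip, of "\<lambda>f. f $ n" M]
  by (simp add: fps_mult_nth)

section \<open>Recovering a multiset from its power sums modulo \<open>p\<close>\<close>

lemma fps_cong_refl [simp]: "fps_cong q d f f"
  by (simp add: fps_cong_def)

lemma fps_cong_mult: "fps_cong q d f g \<Longrightarrow> fps_cong q d f' g' \<Longrightarrow> fps_cong q d (f * f') (g * g')"
  unfolding fps_cong_def fps_mult_nth
  by (intro allI impI cong_sum cong_mult) auto

text \<open>Newton's identity expresses \<open>n + 1\<close> times coefficient \<open>n + 1\<close>
  by earlier coefficients and power sums. The factor can be cancelled modulo \<open>p\<close>
  because \<open>n + 1 \<le> d < p\<close>.\<close>

lemma fps_cong_recip:
  assumes p: "prime p" "d < p"
    and eq: "\<And>i. i \<in> {1..d} \<Longrightarrow> [power_sum u i = power_sum v i] (mod int p)"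
  shows "fps_cong (int p) d (recip_fps u) (recip_fps v)"
  unfolding fps_cong_def
proof (intro allI impI)
  fix i assume "i \<le> d"
  then show "[recip_fps u $ i = recip_fps v $ i] (mod int p)"
  proof (induction i rule: less_induct)
    case (less i)
    show ?case
    proof (cases i)
      case (Suc n)
      have "[int (Suc n) * recip_fps u $ Suc n = int (Suc n) * recip_fps v $ Suc n] (mod int p)"
        unfolding newton_identity
        by (intro cong_minus_minus_iff[THEN iffD2] cong_sum cong_mult less.IH eq)
          (use Suc less.prems in auto)
      moreover have "\<not> int p dvd int (Suc n)"
        using p Suc less.prems by (simp only: int_dvd_int_iff) (auto dest: dvd_imp_le)
      hence "coprime (int (Suc n)) (int p)"
        using p by (metis coprime_commute prime_imp_coprime prime_int_nat_transfer nat_int of_nat_0_le_iff)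
      ultimately show ?thesis
        unfolding Suc by (subst (asm) cong_mult_lcancel) auto
    qed auto
  qed
qed

text \<open>An element \<open>x\<close> of \<open>u\<close> is a root modulo \<open>p\<close> of the
  polynomial with roots \<open>v\<close>. As \<open>p\<close> is prime, \<open>x\<close> is
  congruent to an element of \<open>v\<close>, and equal to it because both lie in
  \<open>{1..p}\<close>. Dividing out the common factor allows induction.\<close>

lemma mset_eq_if_fps_cong:
  assumes p: "prime p"
  shows "size u = size v \<Longrightarrow> set_mset u \<subseteq> {1..int p} \<Longrightarrow> set_mset v \<subseteq> {1..int p} \<Longrightarrow>
    fps_cong (int p) (size u) (recip_fps u) (recip_fps v) \<Longrightarrow> u = v"
proof (induction u arbitrary: v)
  case (add x u)
  let ?k = "Suc (size u)"
  have pp: "prime (int p)" using p by simp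
  \<comment> \<open>Both polynomials are evaluated at \<open>x\<close>, where the left one
    vanishes.\<close>
  have "[(\<Prod>y\<in>#add_mset x u. x - y) = (\<Prod>y\<in>#v. x - y)] (mod int p)"
    unfolding prod_mset_diff_eq add.prems(1)[symmetric]
    by (intro cong_sum cong_mult) (use add.prems(4) in \<open>auto simp: fps_cong_def simp del: recip_fps_add_mset\<close>)
  hence "int p dvd (\<Prod>y\<in>#v. x - y)" by (simp add: cong_0_iff cong_sym_eq[of 0])
  then obtain y where y: "y \<in># v" "int p dvd x - y"
    using prime_dvd_prod_mset_iff[OF pp] by (auto simp: prime_dvd_prod_mset_iff[OF pp])
  have "x \<in> {1..int p}" "y \<in> {1..int p}" using y(1) add.prems(2,3) by auto
  hence "\<bar>x - y\<bar> < int p" by auto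
  hence "x = y" using y(2) zdvd_imp_le[of "int p" "\<bar>x - y\<bar>"] by force
  with y obtain w where w: "v = add_mset x w" by (metis multi_member_split)
  have "fps_cong (int p) ?k (recip_fps u) (recip_fps w)"
  proof -
    \<comment> \<open>Multiplication by the geometric series of \<open>x\<close> removes the factor
      \<open>1 - x X\<close> from both sides.\<close>
    have "fps_cong (int p) ?k (recip_fps (add_mset x u) * Abs_fps (\<lambda>i. x ^ i))
             (recip_fps v * Abs_fps (\<lambda>i. x ^ i))"
      by (intro fps_cong_mult fps_cong_refl) (use add.prems in simp)
    moreover have "recip_fps (add_mset x M) * Abs_fps (\<lambda>i. x ^ i) = recip_fps M" for M :: "int multiset"
    proof -
      have "recip_fps (add_mset x M) * Abs_fps (\<lambda>i. x ^ i)
          = (1 - fps_const x * fps_X) * Abs_fps (\<lambda>i. x ^ i) * recip_fps M"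
        by (simp only: recip_fps_add_mset mult_ac)
      thus ?thesis by (simp only: geom_mult mult_1)
    qed
    ultimately show ?thesis unfolding w by metis
  qed
  hence "fps_cong (int p) (size u) (recip_fps u) (recip_fps w)"
    by (auto simp: fps_cong_def)
  with add.IH[of w] add.prems w show ?case by auto
qed auto

corollary mset_eq_if_power_sums_cong:
  assumes p: "prime p" "d < p" and sz: "size u = size v" "size u \<le> d"
    and "set_mset u \<subseteq> {1..int p}" "set_mset v \<subseteq> {1..int p}"
    and "\<And>i. i \<in> {1..d} \<Longrightarrow> [power_sum u i = power_sum v i] (mod int p)"
  shows "u = v"
proof (rule mset_eq_if_fps_cong[OF p(1)])
  show "fps_cong (int p) (size u) (recip_fps u) (recip_fps v)"
    using fps_cong_recip[OF p, of u v] assms by (auto simp: fps_cong_def)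
qed (use assms in auto)

section \<open>Systems of congruences in power sums\<close>

definition tuples :: "nat \<Rightarrow> nat \<Rightarrow> int list set" where
  "tuples N k = {xs. set xs \<subseteq> {1..int N} \<and> length xs = k}"

lemma finite_tuples [simp]: "finite (tuples N k)"
  unfolding tuples_def by (rule finite_lists_length_eq) simp

lemma card_tuples [simp]: "card (tuples N k) = N ^ k"
  unfolding tuples_def by (subst card_lists_length_eq) simp_all

lemma tuples_Suc: "tuples N (Suc k) = (\<lambda>(x, xs). x # xs) ` ({1..int N} \<times> tuples N k)"
  by (auto simp: tuples_def length_Suc_conv image_iff)

lemma card_permutations_of_multiset_le: "card (permutations_of_multiset M) \<le> fact (size M)"
  unfolding card_permutations_of_multiset by (rule div_le_dividend)

text \<open>All solutions are permutations of any one of them.\<close>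

lemma card_tuples_power_sums:
  assumes p: "prime p" "d < p" and k: "k \<le> d" and N: "N \<le> p"
  shows "card {xs \<in> tuples N k. \<forall>i\<in>{1..d}. [power_sum (mset xs) i = c i] (mod int p)} \<le> fact k"
    (is "card ?A \<le> _")
proof (cases "?A = {}")
  case False
  then obtain ys where ys: "ys \<in> ?A" by blast
  have "?A \<subseteq> permutations_of_multiset (mset ys)"
  proof
    fix xs assume xs: "xs \<in> ?A"
    have "mset xs = mset ys"
    proof (rule mset_eq_if_power_sums_cong[OF p])
      fix i assume "i \<in> {1..d}"
      thus "[power_sum (mset xs) i = power_sum (mset ys) i] (mod int p)"
        using xs ys cong_trans cong_sym by blast
    qed (use xs ys N k in \<open>auto simp: tuples_def\<close>)
    thus "xs \<in> permutations_of_multiset (mset ys)" by (rule permutations_of_multisetI)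
  qed
  hence "card ?A \<le> card (permutations_of_multiset (mset ys))" by (intro card_mono) auto
  also have "\<dots> \<le> fact k" using card_permutations_of_multiset_le[of "mset ys"] ys by (simp add: tuples_def)
  finally show ?thesis .
qed (simp only: card.empty le0)

lemma card_Sigma_le:
  assumes "finite A" "\<And>x. x \<in> A \<Longrightarrow> finite (B x)" "\<And>x. x \<in> A \<Longrightarrow> card (B x) \<le> K"
  shows "card (Sigma A B) \<le> card A * K"
  using assms sum_bounded_above[of A "\<lambda>x. card (B x)" K] by simp

definition equal_power_sums :: "nat \<Rightarrow> nat \<Rightarrow> nat \<Rightarrow> nat \<Rightarrow> (int list \<times> int list) set" where
  "equal_power_sums p d N k = {(xs, ys) \<in> tuples N k \<times> tuples N k.
     \<forall>i\<in>{1..d}. [power_sum (mset xs) i = power_sum (mset ys) i] (mod int p)}"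

lemma card_equal_power_sums_le:
  assumes p: "prime p" "d < p" and k: "k \<le> d" and N: "N \<le> p"
  shows "card (equal_power_sums p d N k) \<le> N ^ k * fact k"
proof -
  let ?B = "\<lambda>xs. {ys \<in> tuples N k. \<forall>i\<in>{1..d}. [power_sum (mset ys) i = power_sum (mset xs) i] (mod int p)}"
  have "equal_power_sums p d N k = Sigma (tuples N k) ?B"
    by (auto simp: equal_power_sums_def cong_sym_eq)
  also have "card \<dots> \<le> card (tuples N k) * fact k"
    by (intro card_Sigma_le card_tuples_power_sums p k N) auto
  finally show ?thesis by simp
qed

text \<open>Choose \<open>xs\<close> and the first \<open>k - d\<close> entries of \<open>ys\<close>
  freely; the last \<open>d\<close> entries then have prescribed power sums and are determined up to
  order.\<close>

lemma card_equal_power_sums_le':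
  assumes p: "prime p" "d < p" and k: "d \<le> k" and N: "N \<le> p"
  shows "card (equal_power_sums p d N k) \<le> N ^ (2 * k - d) * fact d"
proof -
  let ?B = "\<lambda>(xs, zs). {ys \<in> tuples N d. \<forall>i\<in>{1..d}.
     [power_sum (mset ys) i = power_sum (mset xs) i - power_sum (mset zs) i] (mod int p)}"
  let ?S = "Sigma (tuples N k \<times> tuples N (k - d)) ?B"
  have fin: "finite ?S" by (intro finite_SigmaI) auto
  have "equal_power_sums p d N k \<subseteq> (\<lambda>((xs, zs), ys). (xs, zs @ ys)) ` ?S"
  proof safe
    fix xs ys assume xy: "(xs, ys) \<in> equal_power_sums p d N k"
    let ?z = "take (k - d) ys" and ?y = "drop (k - d) ys"
    have "((xs, ?z), ?y) \<in> ?S"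
    proof -
      have tup: "xs \<in> tuples N k" "?z \<in> tuples N (k - d)" "?y \<in> tuples N d"
      proof -
        have "xs \<in> tuples N k" and ys: "set ys \<subseteq> {1..int N}" "length ys = k"
          using xy unfolding equal_power_sums_def tuples_def by blast+
        thus "xs \<in> tuples N k" by blast
        show "?z \<in> tuples N (k - d)" "?y \<in> tuples N d"
          using ys k order_trans[OF set_take_subset ys(1)] order_trans[OF set_drop_subset ys(1)]
          unfolding tuples_def by simp_all
      qed
      have "[power_sum (mset ?y) i = power_sum (mset xs) i - power_sum (mset ?z) i] (mod int p)"
        if "i \<in> {1..d}" for i
      proof -
        have "[power_sum (mset xs) i = power_sum (mset ys) i] (mod int p)"
          using xy that unfolding equal_power_sums_def by blast
        also have "mset ys = mset ?z + mset ?y" by (simp flip: mset_append)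
        finally have "[power_sum (mset xs) i - power_sum (mset ?z) i
            = (power_sum (mset ?z) i + power_sum (mset ?y) i) - power_sum (mset ?z) i] (mod int p)"
          by (intro cong_diff) auto
        thus ?thesis by (simp add: cong_sym_eq)
      qed
      with tup show ?thesis by simp
    qed
    thus "(xs, ys) \<in> (\<lambda>((xs, zs), ys). (xs, zs @ ys)) ` ?S"
      by (rule image_eqI[rotated]) simp
  qed
  hence "card (equal_power_sums p d N k) \<le> card ?S"
    using fin by (rule surj_card_le[rotated])
  also have "\<dots> \<le> card (tuples N k \<times> tuples N (k - d)) * fact d"
    by (intro card_Sigma_le) (auto intro!: card_tuples_power_sums[OF p order.refl N, simplified])
  also have "\<dots> = N ^ (2 * k - d) * fact d"
    using k by (simp add: card_cartesian_product mult_2 flip: power_add)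
  finally show ?thesis .
qed

section \<open>Pairs of tuples with a prescribed nonzero difference of power sums\<close>

text \<open>For a nontrivial series \<open>F\<close>, prepending \<open>x\<close> to \<open>xs\<close> replaces \<open>recip_fps (mset xs) * F\<close> by its
  product with \<open>1 - x X\<close>, so that a nonzero coefficient in the relevant range leaves at most one
  choice for \<open>x\<close>.\<close>
lemma card_vanishing_coeffs_le:
  fixes F :: "int fps"
  assumes p: "prime p" and N: "N \<le> p" and F: "\<exists>j\<in>{1..d}. \<not> [F $ j = 0] (mod int p)"
  shows "s < d \<Longrightarrow> card {xs \<in> tuples N s. \<forall>j\<in>{s<..d}. [(recip_fps (mset xs) * F) $ j = 0] (mod int p)}
           \<le> s * N ^ (s - 1)"
proof (induction s)
  case 0
  \<comment> \<open>For the empty tuple the product is \<open>F\<close> itself, which has a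
    coefficient in \<open>{1..d}\<close> that is nonzero modulo \<open>p\<close>.\<close>
  have "{xs \<in> tuples N 0. \<forall>j\<in>{0<..d}. [(recip_fps (mset xs) * F) $ j = 0] (mod int p)} = {}"
    using F by (auto simp: tuples_def)
  thus ?case by (simp only: card.empty)
next
  case (Suc s)
  define c where "c xs j = (recip_fps (mset xs) * F) $ j" for xs j
  define T where "T s = {xs \<in> tuples N s. \<forall>j\<in>{s<..d}. [c xs j = 0] (mod int p)}" for s
  have c_Cons: "c (x # xs) (Suc j) = c xs (Suc j) - x * c xs j" for x xs j
    by (simp add: c_def mult.assoc linear_mult_nth_Suc)
  define X where "X xs = {x \<in> {1..int N}. x # xs \<in> T (Suc s)}" for xs
  have fin: "finite (X xs)" "finite (T s)" for xs s
    by (auto simp: X_def T_def intro: finite_subset[of _ "{1..int N}"])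
  have X_le_1: "card (X xs) \<le> 1" if xs: "xs \<in> tuples N s - T s" for xs
  proof -
    have "x = y" if x: "x \<in> X xs" and y: "y \<in> X xs" for x y
    proof -
      from xs obtain j where j: "j \<in> {s<..d}" "\<not> [c xs j = 0] (mod int p)" by (auto simp: T_def)
      have cong: "[c xs (Suc i) - z * c xs i = 0] (mod int p)" if "i \<in> {s<..<d}" "z \<in> X xs" for i z
        using that by (auto simp: X_def T_def simp flip: c_Cons)
      \<comment> \<open>The index must be below \<open>d\<close>, so that the condition on
        coefficient \<open>Suc i\<close> is available. If only coefficient \<open>d\<close> were
        nonzero, the condition at \<open>d\<close>, whose second term involves coefficient
        \<open>d - 1\<close>, would force it to vanish too.\<close>
      have "\<exists>i\<in>{s<..<d}. \<not> [c xs i = 0] (mod int p)"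
      proof (rule ccontr)
        assume "\<not> ?thesis"
        hence *: "[c xs i = 0] (mod int p)" if "i \<in> {s<..<d}" for i using that by blast
        with j have "j = d" by (metis greaterThanAtMost_iff greaterThanLessThan_iff le_neq_implies_less)
        have d: "d - 1 \<in> {s<..<d}" "Suc (d - 1) = d" using Suc.prems by auto
        have "int p dvd c xs d - x * c xs (d - 1)" "int p dvd c xs (d - 1)"
          using cong[OF d(1) x] *[OF d(1)] unfolding d(2) by (simp_all only: cong_0_iff)
        hence "[c xs d = 0] (mod int p)"
          by (simp only: cong_0_iff) (metis dvd_mult zdvd_zdiffD)
        with j \<open>j = d\<close> show False by simp
      qed
      then obtain i where i: "i \<in> {s<..<d}" "\<not> [c xs i = 0] (mod int p)" by blast
      have "[(c xs (Suc i) - y * c xs i) - (c xs (Suc i) - x * c xs i) = 0 - 0] (mod int p)"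
        by (intro cong_diff cong i x y)
      hence "int p dvd (x - y) * c xs i" by (simp add: cong_0_iff algebra_simps)
      hence "int p dvd x - y"
        using i p by (metis cong_0_iff prime_dvd_mult_iff prime_nat_int_transfer)
      moreover have "\<bar>x - y\<bar> < int p" using x y N by (auto simp: X_def)
      ultimately show "x = y" using zdvd_imp_le[of "int p" "\<bar>x - y\<bar>"] by force
    qed
    thus ?thesis using fin(1)[of xs] by (simp add: card_le_Suc0_iff_eq)
  qed
  have X_le_N: "card (X xs) \<le> N" for xs
  proof -
    have "X xs \<subseteq> {1..int N}" by (auto simp: X_def)
    from card_mono[OF _ this] show ?thesis by simp
  qed
  have "T (Suc s) \<subseteq> (\<lambda>(xs, x). x # xs) ` Sigma (tuples N s) X"
    by (auto simp: T_def X_def tuples_Suc image_iff)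
  hence "card (T (Suc s)) \<le> card (Sigma (tuples N s) X)"
    by (intro surj_card_le finite_SigmaI fin) auto
  also have "\<dots> = (\<Sum>xs\<in>tuples N s. card (X xs))" using fin by simp
  \<comment> \<open>A tail in \<open>T s\<close> admits at most \<open>N\<close> heads, any other
    tail at most one. This yields the recursion
    \<open>t (s + 1) \<le> N * t s + N ^ s\<close>.\<close>
  also have "\<dots> = (\<Sum>xs\<in>T s. card (X xs)) + (\<Sum>xs\<in>tuples N s - T s. card (X xs))"
    by (subst sum.subset_diff[of "T s"]) (auto simp: T_def)
  also have "\<dots> \<le> card (T s) * N + card (tuples N s - T s) * 1"
    using sum_bounded_above[of "T s" "\<lambda>xs. card (X xs)" N]
      sum_bounded_above[of "tuples N s - T s" "\<lambda>xs. card (X xs)" 1] X_le_N X_le_1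
    by (intro add_mono) auto
  also have "\<dots> \<le> s * N ^ (s - 1) * N + N ^ s"
    using Suc.IH Suc.prems card_mono[of "tuples N s" "tuples N s - T s"]
    by (intro add_mono mult_right_mono) (auto simp: T_def c_def)
  also have "\<dots> = Suc s * N ^ (Suc s - 1)" by (cases s) (auto simp: algebra_simps)
  finally show ?case by (simp only: T_def c_def)
qed

text \<open>Fix one solution \<open>(x0, y0)\<close> and let \<open>F\<close> be the quotient of
  their reciprocal polynomials. Any solution satisfies \<open>recip_fps (mset xs) * F\<close>
  congruent to \<open>recip_fps (mset ys)\<close> up to degree \<open>d\<close>, and the latter has
  degree at most \<open>s\<close>, so coefficients \<open>s + 1\<close> to \<open>d\<close> of the
  product vanish modulo \<open>p\<close>. Given \<open>xs\<close>, the tuple \<open>ys\<close> is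
  determined up to order.\<close>

lemma card_unequal_power_sums_le:
  assumes p: "prime p" "d < p" and s: "s < d" and N: "N \<le> p"
    and c: "\<exists>i\<in>{1..d}. \<not> [c i = 0] (mod int p)"
  shows "card {(xs, ys) \<in> tuples N s \<times> tuples N s.
           \<forall>i\<in>{1..d}. [power_sum (mset xs) i - power_sum (mset ys) i = c i] (mod int p)}
         \<le> s * N ^ (s - 1) * fact s"
    (is "card ?A \<le> _")
proof (cases "?A = {}")
  case False
  then obtain x0 y0 where 0: "(x0, y0) \<in> ?A" by auto
  define F where "F = recip_fps (mset y0) * geom_fps (mset x0)"
  have F_recip: "F * recip_fps (mset x0) = recip_fps (mset y0)"
    using recip_mult_geom[of "mset x0"] by (simp add: F_def mult.assoc mult.commute)
  \<comment> \<open>If \<open>F\<close> were congruent to 1, then \<open>x0\<close> and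
    \<open>y0\<close> would be permutations of each other, making every \<open>c i\<close> zero
    modulo \<open>p\<close>.\<close>
  have F_nontriv: "\<exists>j\<in>{1..d}. \<not> [F $ j = 0] (mod int p)"
  proof (rule ccontr)
    assume *: "\<not> ?thesis"
    have "fps_cong (int p) d F 1"
      unfolding fps_cong_def
    proof (intro allI impI)
      fix i assume "i \<le> d"
      show "[F $ i = 1 $ i] (mod int p)"
      proof (cases i)
        case 0
        have "geom_fps (mset x0) $ 0 = 1"
          using arg_cong[OF recip_mult_geom, of "\<lambda>f. f $ 0" "mset x0"] by simp
        thus ?thesis by (simp add: 0 F_def)
      qed (use * \<open>i \<le> d\<close> in auto)
    qed
    from fps_cong_mult[OF this fps_cong_refl[of _ _ "recip_fps (mset x0)"]]
    have "fps_cong (int p) d (recip_fps (mset y0)) (recip_fps (mset x0))"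
      by (simp add: F_recip)
    hence "mset y0 = mset x0"
      by (intro mset_eq_if_fps_cong[OF p(1)])
        (use 0 s N in \<open>auto simp: tuples_def fps_cong_def\<close>)
    with 0 c show False by (auto simp: cong_sym_eq[of 0])
  qed
  let ?T = "{xs \<in> tuples N s. \<forall>j\<in>{s<..d}. [(recip_fps (mset xs) * F) $ j = 0] (mod int p)}"
  let ?B = "\<lambda>xs. {ys \<in> tuples N s. \<forall>i\<in>{1..d}. [power_sum (mset ys) i = power_sum (mset xs) i - c i] (mod int p)}"
  have "?A \<subseteq> Sigma ?T ?B"
  proof safe
    fix xs ys i assume "i \<in> {1..d}"
      "\<forall>i\<in>{1..d}. [power_sum (mset xs) i - power_sum (mset ys) i = c i] (mod int p)"
    hence "int p dvd power_sum (mset xs) i - power_sum (mset ys) i - c i"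
      by (simp add: cong_iff_dvd_diff)
    hence "int p dvd - (power_sum (mset ys) i - (power_sum (mset xs) i - c i))"
      by (simp add: algebra_simps)
    thus "[power_sum (mset ys) i = power_sum (mset xs) i - c i] (mod int p)"
      by (simp only: cong_iff_dvd_diff dvd_minus_iff)
  next
    fix xs ys j assume xy: "xs \<in> tuples N s" "ys \<in> tuples N s" and j: "j \<in> {s<..d}"
      and eq: "\<forall>i\<in>{1..d}. [power_sum (mset xs) i - power_sum (mset ys) i = c i] (mod int p)"
    have "fps_cong (int p) d (recip_fps (mset xs + mset y0)) (recip_fps (mset ys + mset x0))"
    proof (rule fps_cong_recip[OF p])
      fix i assume "i \<in> {1..d}"
      hence "[power_sum (mset xs) i - power_sum (mset ys) i
              = power_sum (mset x0) i - power_sum (mset y0) i] (mod int p)"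
        using cong_trans[OF bspec[OF eq, of i] cong_sym] 0 by auto
      thus "[power_sum (mset xs + mset y0) i = power_sum (mset ys + mset x0) i] (mod int p)"
        by (simp add: cong_iff_dvd_diff algebra_simps)
    qed
    from fps_cong_mult[OF this fps_cong_refl[of _ _ "geom_fps (mset x0)"]]
    have "fps_cong (int p) d (recip_fps (mset xs) * F) (recip_fps (mset ys))"
      using recip_mult_geom[of "mset x0"] by (simp add: F_def mult.assoc)
    moreover have "recip_fps (mset ys) $ j = 0"
      using xy j by (intro recip_fps_nth_gt) (auto simp: tuples_def)
    ultimately show "[(recip_fps (mset xs) * F) $ j = 0] (mod int p)"
      using j by (auto simp: fps_cong_def dest!: spec[of _ j])
  qed
  hence "card ?A \<le> card (Sigma ?T ?B)" by (intro card_mono finite_SigmaI) auto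
  also have "\<dots> \<le> card ?T * fact s"
    by (intro card_Sigma_le card_tuples_power_sums p N) (use s in auto)
  also have "\<dots> \<le> s * N ^ (s - 1) * fact s"
    by (intro mult_right_mono card_vanishing_coeffs_le p N F_nontriv s) auto
  finally show ?thesis .
qed (simp only: card.empty le0)

section \<open>Additive characters\<close>

definition int_char :: "nat \<Rightarrow> int \<Rightarrow> complex" where
  "int_char p t = e_p p (of_int t)"

definition int_dot :: "nat \<Rightarrow> (nat \<Rightarrow> int) \<Rightarrow> (nat \<Rightarrow> int) \<Rightarrow> int" where
  "int_dot d a b = (\<Sum>i=1..d. a i * b i)"

lemma int_char_0 [simp]: "int_char p 0 = 1"
  by (simp add: int_char_def e_p_def)

lemma int_char_add: "int_char p (s + t) = int_char p s * int_char p t"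
  by (simp add: int_char_def e_p_def ring_distribs add_divide_distrib flip: exp_add)

lemma norm_int_char [simp]: "cmod (int_char p t) = 1"
proof -
  have "2 * of_real pi * \<i> * of_int t / of_nat p = \<i> * of_real (2 * pi * of_int t / of_nat p)"
    by simp
  thus ?thesis unfolding int_char_def e_p_def by (metis norm_exp_i_times)
qed

lemma int_char_minus: "int_char p (- t) = cnj (int_char p t)"
  by (simp add: int_char_def e_p_def exp_cnj)

lemma int_char_diff: "int_char p (s - t) = int_char p s * cnj (int_char p t)"
  using int_char_add[of p s "- t"] by (simp add: int_char_minus)

lemma int_char_sum: "int_char p (\<Sum>i\<in>A. f i) = (\<Prod>i\<in>A. int_char p (f i))"
  by (induction A rule: infinite_finite_induct) (auto simp: int_char_add)

lemma int_char_of_nat_mult: "int_char p (int n * t) = int_char p t ^ n"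
  by (induction n) (auto simp: int_char_add ring_distribs)

lemma int_char_eq_1_iff:
  assumes "p > 0"
  shows "int_char p t = 1 \<longleftrightarrow> int p dvd t"
proof -
  have "int_char p t = exp (\<i> * of_real (2 * pi * of_int t / of_nat p))"
    by (simp add: int_char_def e_p_def mult_ac)
  also have "\<dots> = 1 \<longleftrightarrow> (\<exists>n::int. 2 * pi * of_int t / of_nat p = of_int (2 * n) * pi)"
    unfolding exp_eq_1 by simp
  also have "\<dots> \<longleftrightarrow> (\<exists>n::int. real_of_int t = real_of_int (int p * n))"
    using assms by (intro arg_cong[where f = Ex] ext) (auto simp: field_simps)
  also have "\<dots> \<longleftrightarrow> int p dvd t" unfolding of_int_eq_iff dvd_def ..
  finally show ?thesis .
qed

lemma int_char_cong:
  assumes "p > 0" "[s = t] (mod int p)"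
  shows "int_char p s = int_char p t"
proof -
  have "int_char p (s - t) = 1" using assms by (simp add: int_char_eq_1_iff cong_iff_dvd_diff)
  hence "int_char p (t + (s - t)) = int_char p t" by (simp only: int_char_add) simp
  thus ?thesis by simp
qed

lemma sum_int_char:
  assumes p: "p > 0"
  shows "(\<Sum>t\<in>{0..<int p}. int_char p (t * b)) = (if int p dvd b then of_nat p else 0)"
proof -
  have "(\<Sum>t\<in>{0..<int p}. int_char p (t * b)) = (\<Sum>t\<in>int ` {..<p}. int_char p (t * b))"
    by (simp add: image_int_atLeastLessThan flip: atLeast0LessThan)
  also have "\<dots> = (\<Sum>n<p. int_char p b ^ n)"
    by (simp add: sum.reindex int_char_of_nat_mult)
  also have "\<dots> = (if int p dvd b then of_nat p else 0)"
  proof (cases "int p dvd b")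
    case True
    thus ?thesis using int_char_eq_1_iff[OF p, of b] by simp
  next
    case False
    hence "int_char p b \<noteq> 1" using int_char_eq_1_iff[OF p] by blast
    moreover have "int_char p b ^ p = 1"
      using int_char_eq_1_iff[OF p, of "int p * b"] by (simp flip: int_char_of_nat_mult)
    ultimately show ?thesis using False by (simp add: geometric_sum)
  qed
  finally show ?thesis .
qed

lemma finite_Fp_vecs [simp]: "finite (Fp_vecs p d)"
  by (simp add: Fp_vecs_def finite_PiE)

lemma sum_Fp_vecs_int_char:
  assumes p: "p > 0"
  shows "(\<Sum>a\<in>Fp_vecs p d. int_char p (int_dot d a b))
    = (if \<forall>i\<in>{1..d}. int p dvd b i then of_nat (p ^ d) else 0)"
proof -
  have "(\<Sum>a\<in>Fp_vecs p d. int_char p (int_dot d a b)) = (\<Prod>i=1..d. \<Sum>t\<in>{0..<int p}. int_char p (t * b i))"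
    unfolding Fp_vecs_def int_dot_def int_char_sum by (rule prod_sum_PiE[symmetric]) auto
  also have "\<dots> = (\<Prod>i=1..d. if int p dvd b i then of_nat p else 0)"
    by (simp only: sum_int_char[OF p])
  also have "\<dots> = (if \<forall>i\<in>{1..d}. int p dvd b i then of_nat (p ^ d) else 0)"
    by (auto intro!: prod_zero)
  finally show ?thesis .
qed

lemma int_dot_diff: "int_dot d a (\<lambda>i. b i - c i) = int_dot d a b - int_dot d a c"
  by (simp add: int_dot_def right_diff_distrib sum_subtractf)

lemma int_dot_commute: "int_dot d a b = int_dot d b a"
  by (simp add: int_dot_def mult.commute)

lemma int_dot_cong:
  assumes "\<And>i. i \<in> {1..d} \<Longrightarrow> [b i = b' i] (mod q)"
  shows "[int_dot d a b = int_dot d a b'] (mod q)"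
  unfolding int_dot_def by (intro cong_sum cong_mult cong_refl assms)

text \<open>Parseval's identity: expand the square, exchange the sums and apply orthogonality of the
  characters.\<close>

lemma sum_Fp_vecs_norm_square:
  assumes p: "p > 0" and Z: "finite Z"
  shows "(\<Sum>a\<in>Fp_vecs p d. (cmod (\<Sum>z\<in>Z. int_char p (int_dot d a (f z))))\<^sup>2)
    = real (p ^ d) * real (card {(z, z') \<in> Z \<times> Z. \<forall>i\<in>{1..d}. [f z i = f z' i] (mod int p)})"
proof -
  let ?c = "\<lambda>x. int_char p x"
  let ?P = "\<lambda>z z'. \<forall>i\<in>{1..d}. [f z i = f z' i] (mod int p)"
  have "complex_of_real (\<Sum>a\<in>Fp_vecs p d. (cmod (\<Sum>z\<in>Z. ?c (int_dot d a (f z))))\<^sup>2)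
    = (\<Sum>a\<in>Fp_vecs p d. \<Sum>z\<in>Z. \<Sum>z'\<in>Z. ?c (int_dot d a (\<lambda>i. f z i - f z' i)))"
    by (simp add: complex_norm_square sum_product int_dot_diff int_char_diff del: of_real_power)
  also have "\<dots> = (\<Sum>(z, z')\<in>Z \<times> Z. \<Sum>a\<in>Fp_vecs p d. ?c (int_dot d a (\<lambda>i. f z i - f z' i)))"
    unfolding sum.cartesian_product[symmetric, where A = Z]
    by (subst sum.swap, rule sum.cong[OF refl], rule sum.swap)
  also have "\<dots> = (\<Sum>(z, z')\<in>Z \<times> Z. if ?P z z' then of_nat (p ^ d) else 0)"
    by (simp only: sum_Fp_vecs_int_char[OF p] cong_iff_dvd_diff)
  also have "\<dots> = (\<Sum>x\<in>{(z, z') \<in> Z \<times> Z. ?P z z'}. of_nat (p ^ d))"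
  proof -
    have "{(z, z') \<in> Z \<times> Z. ?P z z'} = {x \<in> Z \<times> Z. ?P (fst x) (snd x)}" by auto
    thus ?thesis
      by (simp only: sum.inter_filter[OF finite_cartesian_product[OF Z Z]]) (simp add: case_prod_beta)
  qed
  also have "\<dots> = complex_of_real (real (p ^ d) * real (card {(z, z') \<in> Z \<times> Z. ?P z z'}))"
    by simp
  finally show ?thesis by (simp only: of_real_eq_iff)
qed

section \<open>Mean values of Weyl sums\<close>

lemma weyl_sum_eq: "weyl_sum p d a N = (\<Sum>x\<in>{1..int N}. int_char p (int_dot d a (\<lambda>i. x ^ i)))"
proof -
  have "{1..int N} = int ` {1..N}" by (simp add: image_int_atLeastAtMost)
  thus ?thesis by (simp add: weyl_sum_def sum.reindex int_char_def int_dot_def)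
qed

lemma weyl_sum_power:
  "weyl_sum p d a N ^ k = (\<Sum>xs\<in>tuples N k. int_char p (int_dot d a (power_sum (mset xs))))"
proof (induction k)
  case 0
  have "tuples N 0 = {[]}" by (auto simp: tuples_def)
  thus ?case by (simp add: power_sum_def int_dot_def)
next
  case (Suc k)
  have "int_dot d a (power_sum (mset (x # xs))) = int_dot d a (\<lambda>i. x ^ i) + int_dot d a (power_sum (mset xs))" for x xs
    by (simp add: int_dot_def power_sum_def ring_distribs sum.distrib)
  thus ?case
    unfolding power_Suc Suc tuples_Suc
    by (subst sum.reindex)
      (auto simp: inj_on_def weyl_sum_eq sum_product sum.cartesian_product int_char_add case_prod_beta
        simp del: mset.simps intro!: sum.cong)
qed

lemma weyl_sum_norm_power:
  "complex_of_real (cmod (weyl_sum p d a N) ^ (2 * s)) = (\<Sum>(xs, ys)\<in>tuples N s \<times> tuples N s.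
     int_char p (int_dot d a (\<lambda>i. power_sum (mset xs) i - power_sum (mset ys) i)))"
proof -
  have "complex_of_real (cmod (weyl_sum p d a N) ^ (2 * s))
      = complex_of_real ((cmod (weyl_sum p d a N ^ s))\<^sup>2)"
    by (simp add: norm_power power_mult power_even_eq mult.commute flip: power_mult)
  also have "\<dots> = weyl_sum p d a N ^ s * cnj (weyl_sum p d a N ^ s)"
    by (rule complex_norm_square)
  also have "\<dots> = (\<Sum>(xs, ys)\<in>tuples N s \<times> tuples N s.
     int_char p (int_dot d a (\<lambda>i. power_sum (mset xs) i - power_sum (mset ys) i)))"
    unfolding weyl_sum_power
    by (simp add: sum_product sum.cartesian_product int_dot_diff int_char_diff case_prod_beta)
  finally show ?thesis .
qed

lemma sum_weyl_sum_power:
  assumes "p > 0"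
  shows "(\<Sum>a\<in>Fp_vecs p d. cmod (weyl_sum p d a N) ^ (2 * k))
    = real (p ^ d) * real (card (equal_power_sums p d N k))"
proof -
  have "cmod (weyl_sum p d a N) ^ (2 * k)
    = (cmod (\<Sum>xs\<in>tuples N k. int_char p (int_dot d a (power_sum (mset xs)))))\<^sup>2" for a
    by (simp add: norm_power mult.commute flip: weyl_sum_power power_mult)
  thus ?thesis
    by (simp only: sum_Fp_vecs_norm_square[OF assms finite_tuples] equal_power_sums_def)
qed

lemma norm_weyl_sum_le: "cmod (weyl_sum p d a N) \<le> real N"
  unfolding weyl_sum_eq by (rule order.trans[OF norm_sum]) simp

lemma mean_value_eq:
  assumes "s > 0"
  shows "mean_value p d (2 * real s) U N = (\<Sum>a\<in>U. cmod (weyl_sum p d a N) ^ (2 * s)) / real (card U)"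
proof -
  have "x powr (2 * real s) = x ^ (2 * s)" if "x \<ge> 0" for x :: real
    using that assms powr_realpow'[of x "2 * s"] by simp
  thus ?thesis by (simp add: mean_value_def)
qed

text \<open>Cauchy-Schwarz over the box, then extension of the nonnegative summands to all of
  \<open>Fp_vecs p d\<close>, where the moment is a count of congruences. The ratio of the
  cardinalities produces \<open>(p / H) ^ d\<close>.\<close>

lemma mean_value_le_sqrt:
  assumes "p > 0" "0 < s" "0 < H" "H \<le> p"
  shows "mean_value p d (2 * real s) (residue_box p d A H) N
    \<le> sqrt ((real p / real H) ^ d * real (card (equal_power_sums p d N (2 * s))))"
proof (rule real_le_rsqrt)
  let ?U = "residue_box p d A H" and ?f = "\<lambda>a. cmod (weyl_sum p d a N)"
  have "(\<Sum>a\<in>?U. ?f a ^ (2 * s))\<^sup>2 \<le> (\<Sum>a\<in>?U. (?f a ^ (2 * s))\<^sup>2) * real (card ?U)"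
    by (rule sum_squared_le_sum_of_squares)
  also have "(\<Sum>a\<in>?U. (?f a ^ (2 * s))\<^sup>2) \<le> (\<Sum>a\<in>Fp_vecs p d. ?f a ^ (2 * (2 * s)))"
    using residue_box_subset[OF assms(1)]
    unfolding power_mult[symmetric] mult.commute[of "2 * s" 2] by (intro sum_mono2) auto
  also have "\<dots> = real (p ^ d) * real (card (equal_power_sums p d N (2 * s)))"
    by (rule sum_weyl_sum_power[OF assms(1)])
  finally have "(\<Sum>a\<in>?U. ?f a ^ (2 * s))\<^sup>2
      \<le> real p ^ d * real (card (equal_power_sums p d N (2 * s))) * real H ^ d"
    by (simp add: card_residue_box assms mult_right_mono)
  thus "(mean_value p d (2 * real s) ?U N)\<^sup>2
      \<le> (real p / real H) ^ d * real (card (equal_power_sums p d N (2 * s)))"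
    using assms by (simp add: mean_value_eq card_residue_box power_divide divide_simps)
      (simp add: power2_eq_square mult_ac)
qed

section \<open>Smoothed sums over integer boxes\<close>

lemma weyl_sum_reduce_mod:
  assumes "p > 0"
  shows "weyl_sum p d (reduce_mod p d a) N = weyl_sum p d a N"
  unfolding weyl_sum_eq
proof (intro sum.cong refl int_char_cong assms)
  fix x :: int
  show "[int_dot d (reduce_mod p d a) (\<lambda>i. x ^ i) = int_dot d a (\<lambda>i. x ^ i)] (mod int p)"
    unfolding int_dot_commute[of d _ "\<lambda>i. x ^ i"]
    by (rule int_dot_cong) (simp add: reduce_mod_def cong_def)
qed

lemma sum_residue_box:
  assumes "p > 0" "H \<le> p"
  shows "(\<Sum>a\<in>residue_box p d A H. f (weyl_sum p d a N))
    = (\<Sum>a\<in>(\<Pi>\<^sub>E i\<in>{1..d}. {A i + 1..A i + int H}). f (weyl_sum p d a N))"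
proof -
  let ?B = "\<Pi>\<^sub>E i\<in>{1..d}. {A i + 1..A i + int H}"
  have "card (reduce_mod p d ` ?B) = card ?B"
    using card_residue_box[OF assms(2), of d A] by (simp add: residue_box_def card_PiE)
  hence "inj_on (reduce_mod p d) ?B" by (intro eq_card_imp_inj_on finite_PiE) auto
  thus ?thesis by (simp add: residue_box_def sum.reindex weyl_sum_reduce_mod[OF assms(1)])
qed

lemma finite_interval_cong [simp]: "finite {t \<in> {a..b::int}. P t}"
  by (rule finite_subset[of _ "{a..b}"]) auto

lemma card_interval_cong_le:
  assumes "p > 0" "L \<le> 2 * p"
  shows "card {t \<in> {a + 1..a + int L}. [c = t] (mod int p)} \<le> 2"
proof -
  let ?I = "\<lambda>b. {t \<in> {b + 1..b + int p}. [c = t] (mod int p)}"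
  have "card (?I b) \<le> 1" for b
  proof -
    have "s = t" if "s \<in> ?I b" "t \<in> ?I b" for s t
    proof -
      have "int p dvd s - t" using that by (auto simp: cong_def mod_eq_dvd_iff[symmetric])
      moreover have "\<bar>s - t\<bar> < int p" using that by auto
      ultimately show ?thesis using zdvd_imp_le[of "int p" "\<bar>s - t\<bar>"] by force
    qed
    moreover have "finite (?I b)" by (rule finite_subset[of _ "{b + 1..b + int p}"]) auto
    ultimately show ?thesis by (simp only: One_nat_def card_le_Suc0_iff_eq) blast
  qed
  from this[of a] this[of "a + int p"] have two: "card (?I a \<union> ?I (a + int p)) \<le> 2"
    using card_Un_le[of "?I a" "?I (a + int p)"] by linarith
  have "finite (?I a \<union> ?I (a + int p))"
    by (rule finite_subset[of _ "{a + 1..a + 2 * int p}"]) auto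
  moreover have "{t \<in> {a + 1..a + int L}. [c = t] (mod int p)} \<subseteq> ?I a \<union> ?I (a + int p)"
    using assms by auto
  ultimately have "card {t \<in> {a + 1..a + int L}. [c = t] (mod int p)} \<le> card (?I a \<union> ?I (a + int p))"
    by (rule card_mono)
  also have "\<dots> \<le> 2" by (rule two)
  finally show ?thesis .
qed

text \<open>By Parseval the sum is \<open>p ^ d\<close> times the number of congruent pairs in the
  box. Each of its \<open>L ^ d\<close> points is congruent to at most \<open>2 ^ d\<close>
  points.\<close>

lemma sum_Fp_vecs_box_le:
  assumes p: "p > 0" and L: "L \<le> 2 * p"
  shows "(\<Sum>\<mu>\<in>Fp_vecs p d. (cmod (\<Sum>w\<in>(\<Pi>\<^sub>E i\<in>{1..d}. {A i + 1..A i + int L}). int_char p (int_dot d \<mu> w)))\<^sup>2)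
    \<le> real (p ^ d) * real ((2 * L) ^ d)"
proof -
  let ?W = "\<Pi>\<^sub>E i\<in>{1..d}. {A i + 1..A i + int L}"
  let ?P = "\<lambda>w w'. \<forall>i\<in>{1..d}. [w i = w' i] (mod int p)"
  have fin: "finite ?W" by (intro finite_PiE) auto
  have "card {w' \<in> ?W. ?P w w'} \<le> 2 ^ d" for w
  proof -
    have "card {w' \<in> ?W. ?P w w'} \<le> card (\<Pi>\<^sub>E i\<in>{1..d}. {t \<in> {A i + 1..A i + int L}. [w i = t] (mod int p)})"
      by (intro card_mono finite_PiE finite_interval_cong) (auto simp: PiE_iff extensional_def)
    also have "\<dots> \<le> (\<Prod>i=1..d. 2)"
      unfolding card_PiE[OF finite_atLeastAtMost]
      by (intro prod_mono conjI card_interval_cong_le[OF p L]) auto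
    finally show ?thesis by simp
  qed
  hence "card (SIGMA w:?W. {w' \<in> ?W. ?P w w'}) \<le> card ?W * 2 ^ d"
    using fin by (intro card_Sigma_le) simp_all
  also have "(SIGMA w:?W. {w' \<in> ?W. ?P w w'}) = {(w, w') \<in> ?W \<times> ?W. ?P w w'}" by auto
  also have "card ?W * 2 ^ d = (2 * L) ^ d"
    by (simp add: card_PiE power_mult_distrib)
  finally show ?thesis
    unfolding sum_Fp_vecs_norm_square[OF p fin, of d "\<lambda>w. w"]
    by (intro mult_left_mono) (simp_all only: of_nat_le_iff of_nat_0_le_iff)
qed

text \<open>After expanding the power and exchanging sums, the character of \<open>w - v\<close>
  splits, so that each pair of tuples contributes a sum over \<open>W\<close> times a conjugated sum
  over \<open>V\<close>.\<close>

lemma sum_norm_weyl_differences_le: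
  fixes W V :: "(nat \<Rightarrow> int) set" and p d :: nat
  defines "char_sum \<equiv> \<lambda>X l. cmod (\<Sum>x\<in>X. int_char p (int_dot d l x))"
  shows "(\<Sum>w\<in>W. \<Sum>v\<in>V. cmod (weyl_sum p d (\<lambda>i. w i - v i) N) ^ (2 * s))
    \<le> (\<Sum>(xs, ys)\<in>tuples N s \<times> tuples N s.
         char_sum W (\<lambda>i. power_sum (mset xs) i - power_sum (mset ys) i) *
         char_sum V (\<lambda>i. power_sum (mset xs) i - power_sum (mset ys) i))"
proof -
  define \<delta> where "\<delta> = (\<lambda>(xs, ys) i. power_sum (mset xs) i - power_sum (mset ys) i)"
  define P where "P = tuples N s \<times> tuples N s"
  define S where "S = (\<Sum>w\<in>W. \<Sum>v\<in>V. cmod (weyl_sum p d (\<lambda>i. w i - v i) N) ^ (2 * s))"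
  define T where "T X z = (\<Sum>x\<in>X. int_char p (int_dot d (\<delta> z) x))" for X z
  have "complex_of_real S = (\<Sum>w\<in>W. \<Sum>v\<in>V. \<Sum>z\<in>P. int_char p (int_dot d (\<lambda>i. w i - v i) (\<delta> z)))"
    by (simp add: S_def P_def \<delta>_def weyl_sum_norm_power case_prod_beta del: of_real_power)
  also have "\<dots> = (\<Sum>w\<in>W. \<Sum>v\<in>V. \<Sum>z\<in>P. int_char p (int_dot d (\<delta> z) w) * cnj (int_char p (int_dot d (\<delta> z) v)))"
    unfolding int_dot_commute[of d _ "\<delta> _"] int_dot_diff int_char_diff ..
  also have "\<dots> = (\<Sum>w\<in>W. \<Sum>z\<in>P. \<Sum>v\<in>V. int_char p (int_dot d (\<delta> z) w) * cnj (int_char p (int_dot d (\<delta> z) v)))"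
    by (rule sum.cong[OF refl]) (rule sum.swap)
  also have "\<dots> = (\<Sum>z\<in>P. \<Sum>w\<in>W. \<Sum>v\<in>V. int_char p (int_dot d (\<delta> z) w) * cnj (int_char p (int_dot d (\<delta> z) v)))"
    by (rule sum.swap)
  also have "\<dots> = (\<Sum>z\<in>P. T W z * cnj (T V z))"
    by (simp only: T_def sum_product cnj_sum)
  finally have S: "complex_of_real S = (\<Sum>z\<in>P. T W z * cnj (T V z))" .
  have "S \<ge> 0" unfolding S_def by (intro sum_nonneg) simp
  hence "S = cmod (complex_of_real S)" by simp
  also have "\<dots> \<le> (\<Sum>z\<in>P. cmod (T W z * cnj (T V z)))"
    unfolding S by (rule norm_sum)
  also have "\<dots> = (\<Sum>z\<in>P. cmod (T W z) * cmod (T V z))"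
    by (simp only: norm_mult complex_mod_cnj)
  finally show ?thesis
    unfolding S_def P_def T_def \<delta>_def char_sum_def by (simp only: case_prod_unfold)
qed

text \<open>Each \<open>a\<close> in the box is a difference \<open>w - v\<close> with \<open>w\<close> in a box of twice the side length, for
  all \<open>v\<close> in \<open>{1..H}\<^sup>d\<close>. Averaging over \<open>v\<close> replaces the Dirichlet kernel of the box by a product of
  two such kernels, whose \<open>L\<^sup>1\<close> norm carries no logarithm.\<close>
lemma sum_box_le_average:
  fixes g :: "(nat \<Rightarrow> int) \<Rightarrow> real"
  assumes g: "\<And>a. g a \<ge> 0" "\<And>a b. (\<And>i. i \<in> {1..d} \<Longrightarrow> a i = b i) \<Longrightarrow> g a = g b"
  shows "real (H ^ d) * (\<Sum>a\<in>(\<Pi>\<^sub>E i\<in>{1..d}. {A i + 1..A i + int H}). g a)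
    \<le> (\<Sum>w\<in>(\<Pi>\<^sub>E i\<in>{1..d}. {A i + 1..A i + int (2 * H)}).
        \<Sum>v\<in>(\<Pi>\<^sub>E i\<in>{1..d}. {0 + 1..0 + int H}). g (\<lambda>i. w i - v i))"
proof -
  let ?B = "\<Pi>\<^sub>E i\<in>{1..d}. {A i + 1..A i + int H}"
  let ?W = "\<Pi>\<^sub>E i\<in>{1..d}. {A i + 1..A i + int (2 * H)}"
  let ?V = "\<Pi>\<^sub>E i\<in>{1..d}. {0 + 1..0 + int H}"
  have le: "(\<Sum>a\<in>?B. g a) \<le> (\<Sum>w\<in>?W. g (\<lambda>i. w i - v i))" if v: "v \<in> ?V" for v
  proof -
    \<comment> \<open>Translation by \<open>v\<close> embeds the box into the doubled one. The
      restriction keeps the result extensional; values outside \<open>{1..d}\<close> are irrelevant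
      to \<open>g\<close> by \<open>g(2)\<close>.\<close>
    define h where "h a = (\<lambda>i\<in>{1..d}. a i + v i)" for a
    have v': "1 \<le> v i \<and> v i \<le> int H" if "i \<in> {1..d}" for i
      using v that by (auto simp: PiE_iff)
    have "inj_on h ?B"
    proof (rule inj_onI)
      fix a b assume ab: "a \<in> ?B" "b \<in> ?B" and eq: "h a = h b"
      show "a = b"
      proof (rule PiE_ext[OF ab])
        fix i assume "i \<in> {1..d}"
        thus "a i = b i" using fun_cong[OF eq, of i] by (simp add: h_def)
      qed
    qed
    hence "(\<Sum>w\<in>h ` ?B. g (\<lambda>i. w i - v i)) = (\<Sum>a\<in>?B. g (\<lambda>i. h a i - v i))"
      by (simp add: sum.reindex)
    also have "\<dots> = (\<Sum>a\<in>?B. g a)"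
      by (intro sum.cong refl g(2)) (simp add: h_def)
    finally have "(\<Sum>a\<in>?B. g a) = (\<Sum>w\<in>h ` ?B. g (\<lambda>i. w i - v i))" ..
    also have "\<dots> \<le> (\<Sum>w\<in>?W. g (\<lambda>i. w i - v i))"
    proof (intro sum_mono2 finite_PiE g(1) image_subsetI)
      fix a assume a: "a \<in> ?B"
      show "h a \<in> ?W"
      proof (rule PiE_I)
        fix i assume i: "i \<in> {1..d}"
        hence "A i + 1 \<le> a i \<and> a i \<le> A i + int H" using a by (auto simp: PiE_iff)
        thus "h a i \<in> {A i + 1..A i + int (2 * H)}" using v'[OF i] i by (auto simp: h_def)
      qed (auto simp: h_def)
    qed auto
    finally show ?thesis .
  qed
  have "card ?V = H ^ d" by (simp add: card_PiE)
  hence "real (H ^ d) * (\<Sum>a\<in>?B. g a) = (\<Sum>v\<in>?V. \<Sum>a\<in>?B. g a)" by simp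
  also have "\<dots> \<le> (\<Sum>v\<in>?V. \<Sum>w\<in>?W. g (\<lambda>i. w i - v i))" by (intro sum_mono le)
  also have "\<dots> = (\<Sum>w\<in>?W. \<Sum>v\<in>?V. g (\<lambda>i. w i - v i))" by (rule sum.swap)
  finally show ?thesis .
qed

text \<open>Pairs with equal power sums get the trivial bound
  \<open>|W| |V| = 2 ^ d * H ^ (2 * d)\<close>; the others are grouped by their difference modulo
  \<open>p\<close> and estimated by Parseval, at most \<open>p ^ d * (4 * H) ^ d\<close> times the
  largest group. Division by \<open>H ^ (2 * d)\<close> gives the two terms.\<close>

lemma mean_value_le_counts:
  assumes p: "prime p" "d < p" and s: "0 < s" "s < d" and H: "0 < H" "H \<le> p" and N: "N \<le> p"
  shows "mean_value p d (2 * real s) (residue_box p d A H) N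
    \<le> 2 ^ d * real (N ^ s * fact s) + 4 ^ d * real (s * N ^ (s - 1) * fact s) * (real p / real H) ^ d"
proof -
  have p0: "p > 0" using p by (simp add: prime_gt_0_nat)
  define g where "g a = cmod (weyl_sum p d a N) ^ (2 * s)" for a
  define B where "B = (\<Pi>\<^sub>E i\<in>{1..d}. {A i + 1..A i + int H})"
  define W where "W = (\<Pi>\<^sub>E i\<in>{1..d}. {A i + 1..A i + int (2 * H)})"
  define V where "V = (\<Pi>\<^sub>E i\<in>{1..d}. {0 + 1..0 + int H})"
  define \<delta> where "\<delta> = (\<lambda>(xs, ys) i. power_sum (mset xs) i - power_sum (mset ys) i)"
  define P where "P = tuples N s \<times> tuples N s"
  define E where "E = equal_power_sums p d N s"
  define F where "F X \<mu> = cmod (\<Sum>x\<in>X. int_char p (int_dot d \<mu> x))" for X \<mu>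
  define K where "K = s * N ^ (s - 1) * fact s"
  define R where "R = real K * (real (p ^ d) * real ((4 * H) ^ d))
    + real (N ^ s * fact s) * (real ((2 * H) ^ d) * real (H ^ d))"
  have finP: "finite P" by (simp add: P_def)
  have E_P: "E \<subseteq> P" by (auto simp: E_def P_def equal_power_sums_def)
  have F_nonneg: "F X \<mu> \<ge> 0" for X \<mu> by (simp add: F_def)
  have F_le: "F X \<mu> \<le> real (card X)" for X \<mu>
    unfolding F_def by (rule order.trans[OF norm_sum]) simp
  have F_reduce: "F X (reduce_mod p d \<mu>) = F X \<mu>" for X \<mu>
    unfolding F_def int_dot_commute[of d "reduce_mod p d \<mu>"] int_dot_commute[of d \<mu>]
    by (intro arg_cong[where f = cmod] sum.cong refl int_char_cong[OF p0] int_dot_cong)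
      (simp add: reduce_mod_def cong_def)
  have card_W: "card W = (2 * H) ^ d" and card_V: "card V = H ^ d"
    by (simp_all add: W_def V_def card_PiE nat_mult_distrib power_mult_distrib)
  have F_sq_W: "(\<Sum>\<mu>\<in>Fp_vecs p d. (F W \<mu>)\<^sup>2) \<le> real (p ^ d) * real ((4 * H) ^ d)"
    using sum_Fp_vecs_box_le[OF p0, of "2 * H" d A] H by (simp only: F_def W_def) (simp add: mult.assoc)
  have F_sq_V: "(\<Sum>\<mu>\<in>Fp_vecs p d. (F V \<mu>)\<^sup>2) \<le> real (p ^ d) * real ((2 * H) ^ d)"
    using sum_Fp_vecs_box_le[OF p0, of H d "\<lambda>_. 0"] H by (simp add: F_def V_def)

  have equal: "(\<Sum>z\<in>E. F W (\<delta> z) * F V (\<delta> z)) \<le> real (N ^ s * fact s) * (real ((2 * H) ^ d) * real (H ^ d))"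
  proof -
    have "(\<Sum>z\<in>E. F W (\<delta> z) * F V (\<delta> z)) \<le> real (card E) * (real (card W) * real (card V))"
      by (intro sum_bounded_above mult_mono F_le F_nonneg) simp
    also have "\<dots> \<le> real (N ^ s * fact s) * (real (card W) * real (card V))"
      unfolding E_def
      using card_equal_power_sums_le[OF p, of s N] s N
      by (intro mult_right_mono) (simp_all only: of_nat_le_iff less_imp_le mult_nonneg_nonneg of_nat_0_le_iff)
    finally show ?thesis by (simp only: card_W card_V)
  qed

  have unequal: "(\<Sum>z\<in>P - E. F W (\<delta> z) * F V (\<delta> z)) \<le> real K * (real (p ^ d) * real ((4 * H) ^ d))"
  proof -
    let ?r = "\<lambda>z. reduce_mod p d (\<delta> z)"
    have r_Fp: "?r z \<in> Fp_vecs p d" for z using p0 by (auto simp: Fp_vecs_def reduce_mod_def)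
    \<comment> \<open>For \<open>\<mu>\<close> nonzero modulo \<open>p\<close> this is the count of
      unequal power sums; over zero the fibre is empty, since such pairs lie in
      \<open>E\<close>.\<close>
    have fibre: "card {z \<in> P - E. ?r z = \<mu>} \<le> K" for \<mu>
    proof (cases "\<exists>i\<in>{1..d}. \<not> [\<mu> i = 0] (mod int p)")
      case True
      have "{z \<in> P - E. ?r z = \<mu>} \<subseteq> {(xs, ys) \<in> tuples N s \<times> tuples N s.
           \<forall>i\<in>{1..d}. [power_sum (mset xs) i - power_sum (mset ys) i = \<mu> i] (mod int p)}"
        by (auto simp: P_def reduce_mod_def \<delta>_def cong_def)
      hence "card {z \<in> P - E. ?r z = \<mu>} \<le> card {(xs, ys) \<in> tuples N s \<times> tuples N s.
           \<forall>i\<in>{1..d}. [power_sum (mset xs) i - power_sum (mset ys) i = \<mu> i] (mod int p)}"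
        by (intro card_mono finite_subset[OF _ finP]) (auto simp: P_def)
      also have "\<dots> \<le> K"
        unfolding K_def by (rule card_unequal_power_sums_le[OF p s(2) N True])
      finally show ?thesis .
    next
      case False
      have "z \<in> E" if "z \<in> P" "?r z = \<mu>" for z
      proof -
        obtain xs ys where z: "z = (xs, ys)" by (cases z)
        have "[power_sum (mset xs) i = power_sum (mset ys) i] (mod int p)" if "i \<in> {1..d}" for i
        proof -
          have "[\<mu> i = 0] (mod int p)" using False that by blast
          moreover have "\<mu> i = (power_sum (mset xs) i - power_sum (mset ys) i) mod int p"
            using that \<open>?r z = \<mu>\<close> by (auto simp: reduce_mod_def \<delta>_def z)
          ultimately show ?thesis by (simp add: cong_iff_dvd_diff dvd_eq_mod_eq_0)
        qed
        with \<open>z \<in> P\<close> show ?thesis by (auto simp: E_def P_def equal_power_sums_def z)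
      qed
      hence "{z \<in> P - E. ?r z = \<mu>} = {}" by blast
      thus ?thesis by (simp only: card.empty le0)
    qed
    have "(\<Sum>z\<in>P - E. F W (\<delta> z) * F V (\<delta> z)) = (\<Sum>z\<in>P - E. F W (?r z) * F V (?r z))"
      by (simp only: F_reduce)
    also have "\<dots> = (\<Sum>\<mu>\<in>Fp_vecs p d. real (card {z \<in> P - E. ?r z = \<mu>}) * (F W \<mu> * F V \<mu>))"
      using finP r_Fp by (intro sum_fun_comp) auto
    \<comment> \<open>The inequality \<open>2 x y \<le> x^2 + y^2\<close> separates the two kernels,
      so that Parseval applies to each.\<close>
    also have "\<dots> \<le> (\<Sum>\<mu>\<in>Fp_vecs p d. real K * (((F W \<mu>)\<^sup>2 + (F V \<mu>)\<^sup>2) / 2))"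
    proof (intro sum_mono mult_mono)
      show "F W \<mu> * F V \<mu> \<le> ((F W \<mu>)\<^sup>2 + (F V \<mu>)\<^sup>2) / 2" for \<mu>
        using sum_squares_bound[of "F W \<mu>" "F V \<mu>"] by simp
      show "real (card {z \<in> P - E. ?r z = \<mu>}) \<le> real K" for \<mu>
        using fibre[of \<mu>] by (simp only: of_nat_le_iff)
    qed (simp_all add: F_nonneg)
    also have "\<dots> = real K * (((\<Sum>\<mu>\<in>Fp_vecs p d. (F W \<mu>)\<^sup>2) + (\<Sum>\<mu>\<in>Fp_vecs p d. (F V \<mu>)\<^sup>2)) / 2)"
      by (simp only: sum_distrib_left[symmetric] sum_divide_distrib[symmetric] sum.distrib)
    also have "\<dots> \<le> real K * (real (p ^ d) * real ((4 * H) ^ d))"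
    proof (rule mult_left_mono)
      have "real (p ^ d) * real ((2 * H) ^ d) \<le> real (p ^ d) * real ((4 * H) ^ d)"
        by (intro mult_left_mono of_nat_mono power_mono) simp_all
      moreover have "(a + b) / 2 \<le> c" if "a \<le> c" "b \<le> e" "e \<le> c" for a b c e :: real
        using that by simp
      ultimately show "((\<Sum>\<mu>\<in>Fp_vecs p d. (F W \<mu>)\<^sup>2) + (\<Sum>\<mu>\<in>Fp_vecs p d. (F V \<mu>)\<^sup>2)) / 2
          \<le> real (p ^ d) * real ((4 * H) ^ d)"
        using F_sq_W F_sq_V by blast
    qed simp
    finally show ?thesis .
  qed

  have "real (H ^ d) * (\<Sum>a\<in>B. g a) \<le> (\<Sum>w\<in>W. \<Sum>v\<in>V. g (\<lambda>i. w i - v i))"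
    unfolding B_def W_def V_def
  proof (rule sum_box_le_average)
    fix a b :: "nat \<Rightarrow> int" assume "\<And>i. i \<in> {1..d} \<Longrightarrow> a i = b i"
    thus "g a = g b" by (simp add: g_def weyl_sum_def)
  qed (simp add: g_def)
  also have "\<dots> \<le> (\<Sum>z\<in>P. F W (\<delta> z) * F V (\<delta> z))"
    using sum_norm_weyl_differences_le[of p d N s V W]
    unfolding g_def P_def F_def \<delta>_def by (simp only: case_prod_unfold)
  also have "\<dots> = (\<Sum>z\<in>P - E. F W (\<delta> z) * F V (\<delta> z)) + (\<Sum>z\<in>E. F W (\<delta> z) * F V (\<delta> z))"
    by (rule sum.subset_diff[OF E_P finP])
  also have "\<dots> \<le> real K * (real (p ^ d) * real ((4 * H) ^ d))
      + real (N ^ s * fact s) * (real ((2 * H) ^ d) * real (H ^ d))"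
    by (intro add_mono equal unequal)
  finally have main: "real (H ^ d) * (\<Sum>a\<in>B. g a) \<le> R" unfolding R_def .
  have "mean_value p d (2 * real s) (residue_box p d A H) N = (\<Sum>a\<in>B. g a) / real (H ^ d)"
    using sum_residue_box[OF p0 H(2), where f = "\<lambda>z. cmod z ^ (2 * s)" and d = d and A = A and N = N]
    by (simp add: mean_value_eq[OF s(1)] card_residue_box[OF H(2)] g_def B_def)
  also have "\<dots> = real (H ^ d) * (\<Sum>a\<in>B. g a) / (real (H ^ d))\<^sup>2"
    using H by (simp add: power2_eq_square)
  also have "\<dots> \<le> R / (real (H ^ d))\<^sup>2"
    by (intro divide_right_mono main) simp
  also have "\<dots> = 2 ^ d * real (N ^ s * fact s) + 4 ^ d * real K * (real p / real H) ^ d"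
    using H by (simp add: R_def add_divide_distrib power_mult_distrib power_divide power2_eq_square)
  finally show ?thesis by (simp only: K_def)
qed

section \<open>Comparison of the bounds with the two minima\<close>

theorem theorem1p5:
  fixes d :: nat
  assumes "d \<ge> 2"
  shows "\<exists>c::real. c > 0 \<and>
    (\<forall>(p::nat) (H::nat) (N::nat) (A::nat \<Rightarrow> int) (s::nat).
      prime p \<and> 0 < H \<and> H \<le> p \<and> 0 < N \<and> N \<le> p \<and> 0 < s \<and> s < d \<longrightarrow>
      \<bar>mean_value p d (2 * real s) (residue_box p d A H) N\<bar> \<le>
        c * (min (real p * inverse (real H) * real N ^ s)
                 (real p powr (1/2) * real H powr (-1/2) *
                    (real N ^ s + real N powr (2 * real s - real d / 2)))
           + min ((real p / real H) ^ d * real N powr (real s - 1/2))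
                 ((real p / real H) powr (real d / 2) *
                    (real N ^ s + real N powr (2 * real s - real d / 2)))))"
proof (intro exI conjI allI impI)
  \<comment> \<open>The first summand serves primes \<open>p > d\<close>; the second bounds
    \<open>N ^ (2 * s)\<close> when \<open>N \<le> p \<le> d\<close>.\<close>
  let ?c = "4 ^ d * real d * fact d + real d ^ (2 * d)"
  show "?c > 0" using assms by (intro add_pos_pos) auto
  fix p H N :: nat and A :: "nat \<Rightarrow> int" and s :: nat
  assume "prime p \<and> 0 < H \<and> H \<le> p \<and> 0 < N \<and> N \<le> p \<and> 0 < s \<and> s < d"
  hence p: "prime p" and H: "0 < H" "H \<le> p" and N: "0 < N" "N \<le> p" and s: "0 < s" "s < d" by auto
  define M where "M = mean_value p d (2 * real s) (residue_box p d A H) N"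
  define L where "L = real p / real H"
  define X where "X = real N ^ s + real N powr (2 * real s - real d / 2)"
  define Y where "Y = min (L * real N ^ s) (L powr (1/2) * X)"
  define Z where "Z = min (L ^ d * real N powr (real s - 1/2)) (L powr (real d / 2) * X)"
  have p0: "p > 0" using H by simp
  have L: "L \<ge> 1" using H by (simp add: L_def)
  have N1: "real N \<ge> 1" using N by simp
  have L_powr: "L powr a \<ge> 1" if "a \<ge> 0" for a using L that by (rule ge_one_powr_ge_zero)
  have X_ge: "real N ^ s \<le> X" by (simp add: X_def)
  have Ns: "1 \<le> real N ^ s" using N1 by (rule one_le_power)
  have X0: "X \<ge> 0" using X_ge Ns by linarith
  \<comment> \<open>Both entries of the first minimum are at least \<open>N ^ s\<close>, because
    \<open>L \<ge> 1\<close> and \<open>X \<ge> N ^ s\<close>. Hence \<open>Y\<close> alone absorbs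
    the contribution of equal power sums.\<close>
  have Y_ge: "real N ^ s \<le> Y"
    unfolding Y_def
    using mult_mono[of 1 L "real N ^ s" "real N ^ s"] mult_mono[of 1 "L powr (1/2)" "real N ^ s" X]
      L L_powr[of "1/2"] X_ge by simp
  have "1 * 1 \<le> L powr (real d / 2) * X"
    using L_powr[of "real d / 2"] X_ge Ns by (intro mult_mono) auto
  moreover have "1 * 1 \<le> L ^ d * real N powr (real s - 1/2)"
    using L s N1 by (intro mult_mono one_le_power ge_one_powr_ge_zero) auto
  ultimately have Z_ge: "1 \<le> Z" by (simp add: Z_def)
  have M0: "M \<ge> 0" unfolding M_def mean_value_eq[OF s(1)] by (intro divide_nonneg_nonneg sum_nonneg) auto
  have "M \<le> ?c * (Y + Z)"
  proof (cases "d < p")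
    case False
    have "M \<le> real N ^ (2 * s)"
    proof -
      have "(\<Sum>a\<in>residue_box p d A H. cmod (weyl_sum p d a N) ^ (2 * s))
          \<le> real (card (residue_box p d A H)) * real N ^ (2 * s)"
        by (intro sum_bounded_above power_mono norm_weyl_sum_le norm_ge_zero)
      thus ?thesis
        unfolding M_def mean_value_eq[OF s(1)] card_residue_box[OF H(2)]
        using H by (simp add: divide_le_eq mult.commute[of _ "real H ^ d"])
    qed
    also have "\<dots> \<le> real d ^ (2 * s)" using False N by (intro power_mono) auto
    also have "\<dots> \<le> real d ^ (2 * d)" using s by (intro power_increasing) auto
    also have "\<dots> \<le> ?c * 1" by simp
    also have "\<dots> \<le> ?c * (Y + Z)"
      using Y_ge Z_ge Ns by (intro mult_left_mono) auto
    finally show ?thesis .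
  next
    case True
    have fact_s: "fact s \<le> (fact d :: real)" using s by (intro fact_mono) auto
    have c_ge: "fact d \<le> ?c"
    proof -
      have "1 * 1 * fact d \<le> 4 ^ d * real d * (fact d :: real)"
        using assms by (intro mult_mono) auto
      thus ?thesis by (simp add: add_increasing2)
    qed
    have C: "M \<le> ?c * (Y + L ^ d * real N powr (real s - 1/2))"
    proof -
      have "M \<le> 2 ^ d * (real N ^ s * fact s) + 4 ^ d * (real s * real N ^ (s - 1) * fact s) * L ^ d"
        using mean_value_le_counts[OF p True s H N(2), of A] by (simp add: M_def L_def)
      also have "\<dots> \<le> (4 ^ d * real d) * (Y * fact d) + 4 ^ d * (real d * real N powr (real s - 1/2) * fact d) * L ^ d"
      proof (intro add_mono mult_mono fact_s Y_ge order.refl)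
        have "2 ^ d * 1 \<le> 4 ^ d * real d" using assms by (intro mult_mono power_mono) auto
        thus "2 ^ d \<le> 4 ^ d * real d" by simp
        have "real N ^ (s - 1) = real N powr (real s - 1)"
          using N s by (simp add: powr_realpow[symmetric] of_nat_diff)
        also have "\<dots> \<le> real N powr (real s - 1/2)" using N1 by (intro powr_mono) auto
        finally show "real N ^ (s - 1) \<le> real N powr (real s - 1/2)" .
      qed (use s L Y_ge Ns in auto)
      also have "\<dots> = (4 ^ d * real d * fact d) * (Y + L ^ d * real N powr (real s - 1/2))"
        by (simp add: algebra_simps)
      also have "\<dots> \<le> ?c * (Y + L ^ d * real N powr (real s - 1/2))"
        using Y_ge Ns L by (intro mult_right_mono) auto
      finally show ?thesis .
    qed
    have D: "M \<le> ?c * (L powr (real d / 2) * X)"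
    proof -
      define J where "J = card (equal_power_sums p d N (2 * s))"
      \<comment> \<open>Each case matches the square of one summand of \<open>X\<close>:
        \<open>N ^ s\<close> if \<open>2 * s \<le> d\<close>, and otherwise
        \<open>N powr (2 * s - d / 2)\<close>, whose square is
        \<open>N ^ (4 * s - d)\<close>.\<close>
      have J: "real J \<le> fact d * X\<^sup>2"
      proof (cases "2 * s \<le> d")
        case le: True
        have "real J \<le> real (N ^ (2 * s) * fact (2 * s))"
          unfolding J_def using card_equal_power_sums_le[OF p True le N(2)] by (simp only: of_nat_le_iff)
        also have "\<dots> = fact (2 * s) * (real N ^ s)\<^sup>2" by (simp add: power_mult mult.commute power_even_eq)
        also have "\<dots> \<le> fact d * X\<^sup>2"
          using le X_ge by (intro mult_mono fact_mono power_mono) auto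
        finally show ?thesis .
      next
        case gt: False
        have "real J \<le> real (N ^ (2 * (2 * s) - d) * fact d)"
          unfolding J_def using card_equal_power_sums_le'[OF p True _ N(2), of "2 * s"] gt
          by (simp only: of_nat_le_iff)
        also have "\<dots> = fact d * real N powr (4 * real s - real d)"
          using gt N by (simp add: powr_realpow[symmetric] of_nat_diff)
        also have "\<dots> = fact d * (real N powr (2 * real s - real d / 2))\<^sup>2"
          using N by (simp add: power2_eq_square powr_add[symmetric])
        also have "\<dots> \<le> fact d * X\<^sup>2"
          by (intro mult_left_mono power_mono) (auto simp: X_def)
        finally show ?thesis .
      qed
      have "M \<le> sqrt (L ^ d * real J)"
        unfolding M_def L_def J_def by (rule mean_value_le_sqrt[OF p0 s(1) H])
      also have "\<dots> \<le> sqrt ((fact d * (L powr (real d / 2) * X))\<^sup>2)"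
      proof (rule real_sqrt_le_mono)
        have "L ^ d = L powr (real d / 2) * L powr (real d / 2)"
          using L by (simp add: powr_realpow flip: powr_add)
        hence "L ^ d * real J \<le> (L powr (real d / 2))\<^sup>2 * (fact d * X\<^sup>2)"
          using J by (simp add: power2_eq_square mult_left_mono)
        \<comment> \<open>Replacing \<open>fact d\<close> by its square makes the bound a perfect
          square.\<close>
        also have "\<dots> \<le> (L powr (real d / 2))\<^sup>2 * ((fact d)\<^sup>2 * X\<^sup>2)"
          using fact_ge_1[of d, where 'a = real] by (intro mult_left_mono mult_right_mono) (auto simp: power2_eq_square)
        finally show "L ^ d * real J \<le> (fact d * (L powr (real d / 2) * X))\<^sup>2"
          by (simp add: power_mult_distrib mult_ac)
      qed
      also have "\<dots> = fact d * (L powr (real d / 2) * X)" using X0 by simp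
      also have "\<dots> \<le> ?c * (L powr (real d / 2) * X)" using X0 c_ge by (intro mult_right_mono) auto
      finally show ?thesis .
    qed
    \<comment> \<open>Adding the nonnegative \<open>Y\<close> brings \<open>D\<close> into the form
      of \<open>C\<close>, so either entry of the minimum \<open>Z\<close> is covered.\<close>
    have "?c * (L powr (real d / 2) * X) \<le> ?c * (Y + L powr (real d / 2) * X)"
      using Y_ge Ns by (intro mult_left_mono) auto
    with D have "M \<le> ?c * (Y + L powr (real d / 2) * X)" by (rule order.trans)
    with C show ?thesis unfolding Z_def min_def by auto
  qed
  hence "\<bar>M\<bar> \<le> ?c * (Y + Z)" using M0 by simp
  moreover have "real p powr (1/2) * real H powr (-1/2) = L powr (1/2)"
    using H p0 by (simp add: L_def powr_divide powr_minus divide_simps)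
  moreover have "real p * inverse (real H) = L" by (simp add: L_def divide_inverse)
  ultimately show "\<bar>mean_value p d (2 * real s) (residue_box p d A H) N\<bar> \<le>
        ?c * (min (real p * inverse (real H) * real N ^ s)
                 (real p powr (1/2) * real H powr (-1/2) *
                    (real N ^ s + real N powr (2 * real s - real d / 2)))
           + min ((real p / real H) ^ d * real N powr (real s - 1/2))
                 ((real p / real H) powr (real d / 2) *
                    (real N ^ s + real N powr (2 * real s - real d / 2))))"
    by (simp only: M_def Y_def Z_def X_def L_def[symmetric])
qed

end
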